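(* Let $D$ be an $n\times n$ unit spherical EDM of embedding dimension $r$, let $1\le k<l\le n$, and let $d_{kl}$ be a yielding entry of $D$. Let $(\tilde z^i)^T$ denote the $i$th row of $\tilde Z$, where $\tilde Z=w$ if $r=n-1$ and $\tilde Z=[\,w\;\;Z\,]$ if $r\le n-2$. Then $T^{\leq}_{kl}=\{0\}$ if and only if $\tilde z^k$ is not parallel to $\tilde z^l$; i.e., if and only if there does not exist a nonzero scalar $c$ such that $w_k=c\,w_l$ and (when $r\le n-2$) $z^k=c\,z^l$.
   Context: An $n\times n$ real matrix $D=(d_{ij})$ is a Euclidean distance matrix (EDM) if there are points $p^1,\dots,p^n$ (generating points) in some Euclidean space with $d_{ij}=\|p^i-p^j\|^2$ for all $i,j$; the dimension of their affine span is the embedding dimension $r$ of $D$. $D$ is spherical of radius $\rho$ if its generating points, taken in $\mathbb{R}^r$, lie on a sphere of radius $\rho$ in $\mathbb{R}^r$ (equivalently, there is a scalar $\beta$ with $\beta ee^T-D\succeq 0$, and the smallest such $\beta$ is $2\rho^2$; $D=0$ counts as spherical of radius $0$). A unit spherical EDM is a spherical EDM of radius $1$. $e$ is the all-ones vector in $\mathbb{R}^n$, $M^\dagger$ is the Moore-Penrose inverse, and $w=D^\dagger e$ (so $Dw=e$). If $r\le n-2$, a Gale matrix $Z$ of $D$ is an $n\times(n-r-1)$ matrix whose columns form a basis of $\{x\in\mathbb{R}^n: P^Tx=0,\ e^Tx=0\}$, where $P$ is the $n\times r$ matrix whose rows are generating points of $D$ in $\mathbb{R}^r$; $(z^i)^T$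 denotes the $i$th row of $Z$. $E^{kl}$ is the $n\times n$ symmetric matrix with $1$'s in positions $kl$ and $lk$ and zeros elsewhere. The entry $d_{kl}$ is yielding if $D+tE^{kl}$ is an EDM for some $t\ne 0$. $T^{\leq}_{kl}$ is the set of real $t$ such that $D+tE^{kl}$ is a spherical EDM of radius $\rho\le 1$. Vectors $u,v$ are parallel if $u=cv$ for some nonzero scalar $c$ (so two zero vectors are parallel). *)

theory Defs
  imports "Jordan_Normal_Form.DL_Rank"
begin

definition eucl_norm :: "real vec \<Rightarrow> real" where
  "eucl_norm v = sqrt (v \<bullet> v)"

definition ones_vec :: "nat \<Rightarrow> real vec" where
  "ones_vec n = vec n (\<lambda>_. 1)"

text \<open>Configurations of \<open>n\<close> points in \<open>m\<close>-dimensional space are stored as the rows of an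
  \<open>n \<times> m\<close> matrix. All indices are 0-based.\<close>

definition generates :: "real mat \<Rightarrow> real mat \<Rightarrow> bool" where
  "generates P D \<longleftrightarrow>
     D \<in> carrier_mat (dim_row P) (dim_row P) \<and>
     (\<forall>i < dim_row P. \<forall>j < dim_row P. D $$ (i, j) = (eucl_norm (row P i - row P j))\<^sup>2)"

definition edm :: "nat \<Rightarrow> real mat \<Rightarrow> bool" where
  "edm n D \<longleftrightarrow> (\<exists>m. \<exists>P \<in> carrier_mat n m. generates P D)"

text \<open>The direction space of the affine span of \<open>p\<^sup>0, \<dots>, p\<^sup>n\<^sup>-\<^sup>1\<close> (\<open>n \<ge> 1\<close>) is the linear span
  of the differences \<open>p\<^sup>i - p\<^sup>0\<close>, so its dimension is the rank of the matrix having these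
  differences as columns.\<close>

definition affine_span_dim :: "real mat \<Rightarrow> nat" where
  "affine_span_dim P =
     vec_space.rank (dim_col P)
       (mat_of_cols (dim_col P) (map (\<lambda>i. row P i - row P 0) [0..<dim_row P]))"

text \<open>The embedding dimension does not depend on the generating points, so it is given as a
  relation between \<open>D\<close> and \<open>r\<close>.\<close>

definition embedding_dim :: "nat \<Rightarrow> real mat \<Rightarrow> nat \<Rightarrow> bool" where
  "embedding_dim n D r \<longleftrightarrow>
     (\<exists>m. \<exists>P \<in> carrier_mat n m. generates P D \<and> affine_span_dim P = r)"

text \<open>Here the points are taken in the Euclidean space whose dimension \<open>r\<close> is the embedding
  dimension, so the sphere is a sphere of the affine span itself. For \<open>D = 0\<close> one has \<open>r = 0\<close>
  and the only possible radius is \<open>0\<close>.\<close>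

definition spherical_edm :: "nat \<Rightarrow> real mat \<Rightarrow> real \<Rightarrow> bool" where
  "spherical_edm n D \<rho> \<longleftrightarrow>
     (\<exists>r. embedding_dim n D r \<and>
       (\<exists>P \<in> carrier_mat n r. \<exists>c \<in> carrier_vec r.
          generates P D \<and> (\<forall>i < n. eucl_norm (row P i - c) = \<rho>)))"

definition moore_penrose_inverse :: "real mat \<Rightarrow> real mat \<Rightarrow> bool" where
  "moore_penrose_inverse A X \<longleftrightarrow>
     X \<in> carrier_mat (dim_col A) (dim_row A) \<and>
     A * X * A = A \<and> X * A * X = X \<and>
     transpose_mat (A * X) = A * X \<and> transpose_mat (X * A) = X * A"

definition gale_space :: "nat \<Rightarrow> real mat \<Rightarrow> real vec set" where
  "gale_space n P =
     {x \<in> carrier_vec n. transpose_mat P *\<^sub>v x = 0\<^sub>v (dim_col P) \<and> ones_vec n \<bullet> x = 0}"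

definition gale_matrix :: "nat \<Rightarrow> real mat \<Rightarrow> nat \<Rightarrow> real mat \<Rightarrow> bool" where
  "gale_matrix n D r Z \<longleftrightarrow>
     Z \<in> carrier_mat n (n - r - 1) \<and>
     (\<exists>P \<in> carrier_mat n r. generates P D \<and>
        distinct (cols Z) \<and>
        vectorspace.basis class_ring
          (module_vec TYPE(real) n\<lparr>carrier := gale_space n P\<rparr>) (set (cols Z)))"

definition sym_unit_mat :: "nat \<Rightarrow> nat \<Rightarrow> nat \<Rightarrow> real mat" where
  "sym_unit_mat n k l =
     mat n n (\<lambda>(i, j). if (i, j) = (k, l) \<or> (i, j) = (l, k) then 1 else 0)"

definition yielding :: "nat \<Rightarrow> real mat \<Rightarrow> nat \<Rightarrow> nat \<Rightarrow> bool" where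
  "yielding n D k l \<longleftrightarrow> (\<exists>t. t \<noteq> 0 \<and> edm n (D + t \<cdot>\<^sub>m sym_unit_mat n k l))"

definition T_le :: "nat \<Rightarrow> real mat \<Rightarrow> nat \<Rightarrow> nat \<Rightarrow> real set" where
  "T_le n D k l = {t. \<exists>\<rho> \<le> 1. spherical_edm n (D + t \<cdot>\<^sub>m sym_unit_mat n k l) \<rho>}"

definition parallel :: "real vec \<Rightarrow> real vec \<Rightarrow> bool" where
  "parallel u v \<longleftrightarrow> (\<exists>c. c \<noteq> 0 \<and> u = c \<cdot>\<^sub>v v)"

definition Z_tilde :: "nat \<Rightarrow> nat \<Rightarrow> real vec \<Rightarrow> real mat \<Rightarrow> real mat" where
  "Z_tilde n r w Z =
     (if r = n - 1 then mat_of_cols n [w] else mat_of_cols n (w # cols Z))"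

end

theory Submission
  imports Defs "Jordan_Normal_Form.Matrix_Kernel"
begin

text \<open>
  Place the generating points \<open>p\<^sup>i\<close> on the unit sphere about the origin and let
  \<open>N = {x. \<Sum>\<^sub>i x\<^sub>i p\<^sup>i = 0}\<close>. Since \<open>D = 2 (e e\<^sup>T - P P\<^sup>T)\<close>, the number \<open>t\<close> lies in
  \<open>T\<^sup>\<le>\<close> iff \<open>2 P P\<^sup>T - t E\<^sup>k\<^sup>l\<close> is positive semidefinite, i.e. iff
  \<open>t x\<^sub>k x\<^sub>l \<le> |\<Sum>\<^sub>i x\<^sub>i p\<^sup>i|\<^sup>2\<close> for all \<open>x\<close>. A nonzero such \<open>t\<close> exists iff the two coordinate
  functionals \<open>x\<^sub>k\<close> and \<open>x\<^sub>l\<close> are nonzero multiples of each other on \<open>N\<close>. The origin lies in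
  the affine span of the points, which gives \<open>P\<^sup>T w = 0\<close> and \<open>e\<^sup>T w = 1/2\<close>; so \<open>N\<close> is
  spanned by \<open>w\<close> and the Gale space, and proportionality on \<open>N\<close> is parallelism of the rows of
  \<open>[w Z]\<close>.
\<close>

subsection \<open>Rank and kernel of a matrix\<close>

lemma (in vec_space) mult_mat_vec_linear_map:
  assumes "A \<in> carrier_mat n nc"
  shows "linear_map class_ring (module_vec TYPE('a) nc) V (\<lambda>x. A *\<^sub>v x)"
proof -
  interpret NC: vec_space "TYPE('a)" nc .
  have "(\<lambda>x. A *\<^sub>v x) \<in> LinearCombinations.module_hom class_ring NC.V V"
    using mult_add_distrib_mat_vec[OF assms] mult_mat_vec[OF assms] assms
    by (auto simp: LinearCombinations.module_hom_def)
  then show ?thesis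
    by (intro linear_map.intro mod_hom.intro vec_vs vec_module mod_hom_axioms.intro)
qed

text \<open>The kernel appears as an explicit set, so that matrices with different numbers of rows
  but the same kernel are seen to have equal rank.\<close>

lemma (in vec_space) rank_nullity_mat:
  assumes A: "A \<in> carrier_mat n nc"
  shows "rank A + vectorspace.dim class_ring
    (module_vec TYPE('a) nc\<lparr>carrier := {x \<in> carrier_vec nc. A *\<^sub>v x = 0\<^sub>v n}\<rparr>) = nc"
proof -
  interpret NC: vec_space "TYPE('a)" nc .
  interpret L: linear_map class_ring NC.V V "\<lambda>x. A *\<^sub>v x"
    by (rule mult_mat_vec_linear_map[OF A])
  have ker: "L.ker = {x \<in> carrier_vec nc. A *\<^sub>v x = 0\<^sub>v n}"
    by (simp add: L.ker_def)
  have "L.im = span (set (cols A))"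
    using col_space_eq[OF A] A by (auto simp: L.im_def col_space_def)
  then show ?thesis
    using L.rank_nullity[OF NC.fin_dim] unfolding ker rank_def by (simp add: NC.dim_is_n)
qed

lemma (in vec_space) rank_eq_nc_imp_kernel:
  assumes A: "A \<in> carrier_mat n nc" and r: "rank A = nc"
    and x: "x \<in> carrier_vec nc" "A *\<^sub>v x = 0\<^sub>v n"
  shows "x = 0\<^sub>v nc"
proof -
  interpret K: kernel n nc A by unfold_locales (rule A)
  have ker: "mat_kernel A = {x \<in> carrier_vec nc. A *\<^sub>v x = 0\<^sub>v n}"
    by (rule mat_kernel[OF A])
  have "K.dim = 0" using rank_nullity_mat[OF A] r by (simp add: ker)
  moreover obtain B where B: "finite B" "K.basis B" using kernel_basis_exists[OF A] by blast
  ultimately have "B = {}" using K.Ker.dim_basis[OF B] by simp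
  then have "mat_kernel A = {0\<^sub>v nc}"
    using B(2) unfolding K.Ker.basis_def by (simp add: K.Ker.span_empty)
  then show ?thesis using x unfolding ker by blast
qed

text \<open>For the forward direction, a basis of the column space consists of \<open>n\<close>
  independent vectors and is therefore a basis of the whole space.\<close>

lemma (in vec_space) rank_eq_dim_iff_surj:
  assumes A: "A \<in> carrier_mat n nc"
  shows "rank A = n \<longleftrightarrow> (\<forall>b \<in> carrier_vec n. \<exists>x \<in> carrier_vec nc. A *\<^sub>v x = b)"
proof -
  have cs: "set (cols A) \<subseteq> carrier_vec n" using A cols_dim by blast
  have sub: "subspace class_ring (span (set (cols A))) V"
    using cs span_is_subspace by simp
  interpret S: vectorspace class_ring "vs (span (set (cols A)))"
    by (rule subspace_is_vs[OF sub])
  have im: "span (set (cols A)) = {y \<in> carrier_vec n. \<exists>x\<in>carrier_vec nc. A *\<^sub>v x = y}"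
    using col_space_eq[OF A] A by (simp add: col_space_def)
  show ?thesis
  proof
    assume "\<forall>b \<in> carrier_vec n. \<exists>x \<in> carrier_vec nc. A *\<^sub>v x = b"
    then have "span (set (cols A)) = carrier_vec n" using im by auto
    then have "vs (span (set (cols A))) = V" by (simp add: module_vec_def)
    then show "rank A = n" using dim_is_n unfolding rank_def by simp
  next
    assume r: "rank A = n"
    have "S.fin_dim" by (rule fin_dim_span_cols[OF A])
    then obtain B where B: "finite B" "S.basis B" using S.finite_basis_exists by blast
    have cB: "card B = n" using S.dim_basis[OF B] r unfolding rank_def by simp
    have Bs: "B \<subseteq> span (set (cols A))" and "S.lin_indpt B" using B(2) unfolding S.basis_def by auto
    then have "lin_indpt B"
      using span_li_not_depend(2)[OF Bs] sub by (simp add: subspace_def)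
    moreover have Bc: "B \<subseteq> carrier_vec n" using Bs im by auto
    ultimately have "basis B" using dim_li_is_basis[of B] B(1) cB by (simp add: dim_is_n)
    then have "span B = carrier_vec n" unfolding basis_def by simp
    moreover have "span B \<subseteq> span (set (cols A))"
      using span_is_subset[OF Bs] sub by (simp add: subspace_def)
    ultimately show "\<forall>b \<in> carrier_vec n. \<exists>x \<in> carrier_vec nc. A *\<^sub>v x = b"
      using im by auto
  qed
qed

subsection \<open>Configurations of points in coordinates\<close>

text \<open>Finite-dimensional duality, by induction on the number of functionals. If the last one
  vanishes on the common kernel of the others, it gets coefficient 0; otherwise a multiple of it is
  subtracted from \<open>v\<close> so that the rest vanishes on that kernel.\<close>

lemma functional_in_span:
  fixes f :: "nat \<Rightarrow> nat \<Rightarrow> real" and v :: "nat \<Rightarrow> real"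
  assumes "\<And>x. (\<And>j. j < m \<Longrightarrow> (\<Sum>i<n. f j i * x i) = 0) \<Longrightarrow> (\<Sum>i<n. v i * x i) = 0"
  shows "\<exists>y. \<forall>i<n. v i = (\<Sum>j<m. y j * f j i)"
  using assms
proof (induction m arbitrary: v)
  case 0
  have "v i = 0" if "i < n" for i
  proof -
    have "(\<Sum>j<n. v j * (if j = i then 1 else 0)) = 0" using "0.prems" by simp
    then show ?thesis using that by (simp add: if_distrib cong: if_cong)
  qed
  then show ?case by simp
next
  case (Suc m)
  show ?case
  proof (cases "\<exists>x. (\<forall>j<m. (\<Sum>i<n. f j i * x i) = 0) \<and> (\<Sum>i<n. f m i * x i) \<noteq> 0")
    case False
    then have "(\<Sum>i<n. v i * x i) = 0" if "\<And>j. j < m \<Longrightarrow> (\<Sum>i<n. f j i * x i) = 0" for x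
      using Suc.prems[of x] that by (metis less_Suc_eq)
    then obtain y where y: "\<forall>i<n. v i = (\<Sum>j<m. y j * f j i)" using Suc.IH by blast
    have "\<forall>i<n. v i = (\<Sum>j<Suc m. (y(m := 0)) j * f j i)"
      using y by simp
    then show ?thesis by blast
  next
    case True
    then obtain x0 where x0: "\<And>j. j < m \<Longrightarrow> (\<Sum>i<n. f j i * x0 i) = 0"
      and nz: "(\<Sum>i<n. f m i * x0 i) \<noteq> 0" by blast
    define s where "s = (\<Sum>i<n. f m i * x0 i)"
    define b where "b = (\<Sum>i<n. v i * x0 i) / s"
    have "(\<Sum>i<n. (v i - b * f m i) * x i) = 0"
      if x: "\<And>j. j < m \<Longrightarrow> (\<Sum>i<n. f j i * x i) = 0" for x
    proof -
      \<comment> \<open>With this \<open>q\<close>, the vector \<open>x - q x0\<close> is also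
        killed by the last functional.\<close>
      define q where "q = (\<Sum>i<n. f m i * x i) / s"
      have lin: "(\<Sum>i<n. g i * (x i - q * x0 i)) = (\<Sum>i<n. g i * x i) - q * (\<Sum>i<n. g i * x0 i)"
        for g :: "nat \<Rightarrow> real"
        by (simp add: sum_subtractf sum_distrib_left algebra_simps)
      have "(\<Sum>i<n. f j i * (x i - q * x0 i)) = 0" if "j < Suc m" for j
        using that x x0 nz unfolding lin by (cases "j = m") (auto simp: q_def s_def)
      then have "(\<Sum>i<n. v i * (x i - q * x0 i)) = 0" by (rule Suc.prems)
      then have "(\<Sum>i<n. v i * x i) = b * (\<Sum>i<n. f m i * x i)"
        unfolding lin by (simp add: q_def b_def)
      moreover have "(\<Sum>i<n. (v i - b * f m i) * x i)
        = (\<Sum>i<n. v i * x i) - b * (\<Sum>i<n. f m i * x i)"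
        by (simp add: sum_subtractf sum_distrib_left algebra_simps)
      ultimately show ?thesis by simp
    qed
    then obtain y where y: "\<forall>i<n. v i - b * f m i = (\<Sum>j<m. y j * f j i)"
      using Suc.IH[of "\<lambda>i. v i - b * f m i"] by blast
    have "v i = (\<Sum>j<Suc m. (y(m := b)) j * f j i)" if "i < n" for i
      using y[rule_format, OF that] by simp
    then show ?thesis by blast
  qed
qed

text \<open>Expanding the square in each coordinate separates the double sum. If the entries of
  \<open>x\<close> sum to 0, only minus twice a sum of squares is left.\<close>

lemma sum_mult_sq_dist:
  fixes p :: "nat \<Rightarrow> nat \<Rightarrow> real" and x :: "nat \<Rightarrow> real"
  shows "(\<Sum>i<n. \<Sum>j<n. x i * x j * (\<Sum>a<m. (p i a - p j a)\<^sup>2)) =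
    2 * (\<Sum>i<n. x i) * (\<Sum>i<n. x i * (\<Sum>a<m. (p i a)\<^sup>2)) - 2 * (\<Sum>a<m. (\<Sum>i<n. x i * p i a)\<^sup>2)"
proof -
  have coord: "(\<Sum>i<n. \<Sum>j<n. x i * x j * (p i a - p j a)\<^sup>2) =
     2 * (\<Sum>i<n. x i) * (\<Sum>i<n. x i * (p i a)\<^sup>2) - 2 * (\<Sum>i<n. x i * p i a)\<^sup>2" for a
  proof -
    have "(\<Sum>i<n. \<Sum>j<n. x i * x j * (p i a - p j a)\<^sup>2) =
      (\<Sum>i<n. \<Sum>j<n. (x i * (p i a)\<^sup>2) * x j + x i * (x j * (p j a)\<^sup>2) - 2 * ((x i * p i a) * (x j * p j a)))"
      by (intro sum.cong refl) (simp add: power2_eq_square algebra_simps)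
    also have "\<dots> = (\<Sum>i<n. x i * (p i a)\<^sup>2) * (\<Sum>j<n. x j) + (\<Sum>i<n. x i) * (\<Sum>j<n. x j * (p j a)\<^sup>2)
       - 2 * ((\<Sum>i<n. x i * p i a) * (\<Sum>j<n. x j * p j a))"
      by (simp only: sum.distrib sum_subtractf sum_distrib_left[symmetric] sum_distrib_right[symmetric])
    finally show ?thesis by (simp add: power2_eq_square algebra_simps)
  qed
  have "(\<Sum>i<n. \<Sum>j<n. x i * x j * (\<Sum>a<m. (p i a - p j a)\<^sup>2)) =
      (\<Sum>i<n. \<Sum>j<n. \<Sum>a<m. x i * x j * (p i a - p j a)\<^sup>2)"
    by (simp add: sum_distrib_left)
  also have "\<dots> = (\<Sum>i<n. \<Sum>a<m. \<Sum>j<n. x i * x j * (p i a - p j a)\<^sup>2)"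
    by (intro sum.cong refl sum.swap)
  also have "\<dots> = (\<Sum>a<m. \<Sum>i<n. \<Sum>j<n. x i * x j * (p i a - p j a)\<^sup>2)"
    by (rule sum.swap)
  also have "\<dots> = (\<Sum>a<m. 2 * (\<Sum>i<n. x i) * (\<Sum>i<n. x i * (p i a)\<^sup>2)) - 2 * (\<Sum>a<m. (\<Sum>i<n. x i * p i a)\<^sup>2)"
    by (simp add: coord sum_subtractf sum_distrib_left)
  also have "(\<Sum>a<m. 2 * (\<Sum>i<n. x i) * (\<Sum>i<n. x i * (p i a)\<^sup>2)) =
     2 * (\<Sum>i<n. x i) * (\<Sum>a<m. \<Sum>i<n. x i * (p i a)\<^sup>2)"
    by (simp add: sum_distrib_left)
  also have "(\<Sum>a<m. \<Sum>i<n. x i * (p i a)\<^sup>2) = (\<Sum>i<n. x i * (\<Sum>a<m. (p i a)\<^sup>2))"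
    unfolding sum_distrib_left by (rule sum.swap)
  finally show ?thesis .
qed

text \<open>For a unit vector \<open>y\<close>, the map \<open>z \<mapsto> z - ((y \<bullet> z + z\<^sub>m) / (1 + y\<^sub>m)) y\<close> is, in all but the
  last coordinate, the Householder reflection exchanging \<open>y\<close> and \<open>-e\<^sub>m\<close>; the reflected vector has
  last coordinate \<open>- y \<bullet> z\<close>.\<close>

lemma sum_sq_householder:
  fixes y z :: "nat \<Rightarrow> real"
  assumes unit: "(\<Sum>a<Suc m. (y a)\<^sup>2) = 1" and last: "y m \<ge> 0"
  shows "(\<Sum>a<m. (z a - ((\<Sum>b<Suc m. y b * z b) + z m) / (1 + y m) * y a)\<^sup>2) =
    (\<Sum>a<Suc m. (z a)\<^sup>2) - (\<Sum>a<Suc m. y a * z a)\<^sup>2"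
proof -
  define q where "q = (\<Sum>b<Suc m. y b * z b)"
  define \<kappa> where "\<kappa> = (q + z m) / (1 + y m)"
  define s where "s = (\<Sum>a<m. y a * z a)"
  have \<kappa>: "\<kappa> * (1 + y m) = q + z m" using last by (simp add: \<kappa>_def)
  have s: "s = q - y m * z m" by (simp add: s_def q_def)
  have Y: "(\<Sum>a<m. (y a)\<^sup>2) = 1 - (y m)\<^sup>2" using unit by simp
  have "(\<Sum>a<m. (z a - \<kappa> * y a)\<^sup>2) = (\<Sum>a<m. (z a)\<^sup>2 - 2 * \<kappa> * (y a * z a) + \<kappa>\<^sup>2 * (y a)\<^sup>2)"
    by (intro sum.cong refl) (simp add: power2_eq_square algebra_simps)
  also have "\<dots> = (\<Sum>a<m. (z a)\<^sup>2) - 2 * \<kappa> * s + \<kappa>\<^sup>2 * (1 - (y m)\<^sup>2)"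
    by (simp only: sum.distrib sum_subtractf sum_distrib_left[symmetric] s_def Y)
  also have "\<kappa>\<^sup>2 * (1 - (y m)\<^sup>2) = \<kappa> * (\<kappa> * (1 + y m)) * (1 - y m)"
    by (simp add: power2_eq_square algebra_simps)
  also have "\<dots> = \<kappa> * (q + z m) * (1 - y m)" unfolding \<kappa> ..
  also have "(\<Sum>a<m. (z a)\<^sup>2) - 2 * \<kappa> * s + \<kappa> * (q + z m) * (1 - y m)
    = (\<Sum>a<m. (z a)\<^sup>2) + \<kappa> * (1 + y m) * (z m - q)"
    unfolding s by (simp add: algebra_simps)
  also have "\<dots> = (\<Sum>a<Suc m. (z a)\<^sup>2) - q\<^sup>2"
    unfolding \<kappa> by (simp add: power2_eq_square algebra_simps)
  finally show ?thesis unfolding \<kappa>_def q_def .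
qed

lemma sum_if_two:
  fixes f :: "nat \<Rightarrow> real"
  assumes "k < n" "l < n" "k \<noteq> l"
  shows "(\<Sum>i<n. (if i = k then b else if i = l then c else 0) * f i) = b * f k + c * f l"
proof -
  have "(\<Sum>i<n. (if i = k then b else if i = l then c else 0) * f i) =
     (\<Sum>i<n. (if i = k then b * f i else 0) + (if i = l then c * f i else 0))"
    by (intro sum.cong refl) (use assms in auto)
  then show ?thesis using assms by (simp add: sum.distrib)
qed

text \<open>Testing the inequality on \<open>s x + e\<^sub>l\<close> with \<open>x \<in> N\<close>, \<open>x\<^sub>l = 0\<close> and \<open>s\<close> arbitrary forces \<open>x\<^sub>k = 0\<close>.\<close>

lemma psd_perturbation_imp_proportional:
  fixes p :: "nat \<Rightarrow> nat \<Rightarrow> real" and t :: real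
  assumes kl: "k < n" "l < n" "k \<noteq> l" and "t \<noteq> 0"
    and psd: "\<And>x. t * x k * x l \<le> (\<Sum>a<m. (\<Sum>i<n. x i * p i a)\<^sup>2)"
  shows "\<exists>c. c \<noteq> 0 \<and> (\<forall>x. (\<forall>a<m. (\<Sum>i<n. x i * p i a) = 0) \<longrightarrow> x k = c * x l)"
proof -
  \<comment> \<open>\<open>k\<close> and \<open>l\<close> are bound anew because the claim is
    applied in both orders.\<close>
  have aux: "x k = 0"
    if kl: "k < n" "l < n" "k \<noteq> l" and x: "\<And>a. a < m \<Longrightarrow> (\<Sum>i<n. x i * p i a) = 0" "x l = 0"
      and psd: "\<And>x. t * x k * x l \<le> (\<Sum>a<m. (\<Sum>i<n. x i * p i a)\<^sup>2)" for k l x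
  proof (rule ccontr)
    assume nz: "x k \<noteq> 0"
    define C where "C = (\<Sum>a<m. (p l a)\<^sup>2)"
    \<comment> \<open>This makes the left side of the inequality for \<open>z\<close> equal to
      \<open>C + 1\<close>, while the right side stays \<open>C\<close>.\<close>
    define s where "s = (C + 1) / (t * x k)"
    define z where "z = (\<lambda>i. s * x i + (if i = l then 1 else 0))"
    have "(\<Sum>i<n. z i * p i a) = s * (\<Sum>i<n. x i * p i a) + p l a" for a
    proof -
      have "(\<Sum>i<n. z i * p i a) = (\<Sum>i<n. s * (x i * p i a) + (if i = l then p i a else 0))"
        by (intro sum.cong refl) (simp add: z_def algebra_simps)
      then show ?thesis using kl by (simp add: sum.distrib sum_distrib_left)
    qed
    then have "(\<Sum>a<m. (\<Sum>i<n. z i * p i a)\<^sup>2) = C" using x by (simp add: C_def)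
    moreover have "t * z k * z l = C + 1"
      using kl x nz \<open>t \<noteq> 0\<close> by (simp add: z_def s_def)
    ultimately show False using psd[of z] by simp
  qed
  let ?N = "\<lambda>x. \<forall>a<m. (\<Sum>i<n. x i * p i a) = 0"
  have lk: "x k = 0" if "?N x" "x l = 0" for x
    by (rule aux[of k l x]) (use kl that psd in auto)
  have kl0: "x l = 0" if "?N x" "x k = 0" for x
    by (rule aux[of l k x]) (use kl that psd in \<open>auto simp: mult.commute mult.left_commute\<close>)
  show ?thesis
  proof (cases "\<exists>x. ?N x \<and> x l \<noteq> 0")
    case False
    \<comment> \<open>Both coordinates vanish on the whole kernel, so the constant 1 serves.\<close>
    then have "\<forall>x. ?N x \<longrightarrow> x k = 1 * x l" using lk by fastforce
    then show ?thesis by (metis zero_neq_one)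
  next
    case True
    then obtain u where u: "?N u" "u l \<noteq> 0" by blast
    have "u k \<noteq> 0" using kl0 u by blast
    moreover have "x k = u k / u l * x l" if x: "?N x" for x
    proof -
      define v where "v = (\<lambda>i. x i - x l / u l * u i)"
      have "(\<Sum>i<n. v i * p i a) = (\<Sum>i<n. x i * p i a) - x l / u l * (\<Sum>i<n. u i * p i a)" for a
        by (simp add: v_def sum_subtractf sum_distrib_left algebra_simps)
      then have "?N v" using x u by simp
      moreover have "v l = 0" using u by (simp add: v_def)
      ultimately have "v k = 0" by (rule lk)
      then show ?thesis by (simp add: v_def)
    qed
    ultimately show ?thesis using u by (metis divide_eq_0_iff)
  qed
qed

text \<open>If \<open>e\<^sub>k - c e\<^sub>l\<close> annihilates \<open>N\<close>, it equals \<open>P y\<close> with \<open>P\<close> the matrix of the \<open>p\<^sup>i\<close>. The new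
  points \<open>q\<^sup>i\<close> are the projections of the \<open>p\<^sup>i\<close> along \<open>y\<close>, extended by the coordinate
  \<open>(e\<^sub>k + c e\<^sub>l)\<^sub>i / |y|\<close>; since
  \<open>(e\<^sub>k + c e\<^sub>l)(e\<^sub>k + c e\<^sub>l)\<^sup>T - (e\<^sub>k - c e\<^sub>l)(e\<^sub>k - c e\<^sub>l)\<^sup>T = 2 c E\<^sup>k\<^sup>l\<close>, the Gram matrix changes by
  \<open>(2 c / |y|\<^sup>2) E\<^sup>k\<^sup>l\<close>.\<close>

lemma proportional_imp_unit_configuration:
  fixes p :: "nat \<Rightarrow> nat \<Rightarrow> real"
  assumes kl: "k < n" "l < n" "k \<noteq> l" and "c \<noteq> 0"
    and unit: "\<And>i. i < n \<Longrightarrow> (\<Sum>a<m. (p i a)\<^sup>2) = 1"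
    and ratio: "\<And>x. (\<And>a. a < m \<Longrightarrow> (\<Sum>i<n. x i * p i a) = 0) \<Longrightarrow> x k = c * x l"
  shows "\<exists>q t. t \<noteq> 0 \<and> (\<forall>i<n. (\<Sum>a<Suc m. (q i a)\<^sup>2) = 1) \<and>
    (\<forall>i<n. \<forall>j<n. (\<Sum>a<Suc m. (q i a - q j a)\<^sup>2) =
       (\<Sum>a<m. (p i a - p j a)\<^sup>2) + (if (i, j) = (k, l) \<or> (i, j) = (l, k) then t else 0))"
proof -
  \<comment> \<open>This is e_k - c e_l; by \<open>ratio\<close> it vanishes on the kernel, so it is
    a combination of the coordinate functions of the points.\<close>
  define v where "v = (\<lambda>i. if i = k then 1 else if i = l then - c else 0)"
  have "(\<Sum>i<n. v i * x i) = 0" if "\<And>a. a < m \<Longrightarrow> (\<Sum>i<n. p i a * x i) = 0" for x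
  proof -
    have "x k = c * x l" by (rule ratio) (use that in \<open>simp add: mult.commute\<close>)
    then show ?thesis unfolding v_def sum_if_two[OF kl] by simp
  qed
  then obtain y where "\<forall>i<n. v i = (\<Sum>a<m. y a * p i a)"
    using functional_in_span[where m = m and n = n and f = "\<lambda>a i. p i a" and v = v] by blast
  then have y: "(\<Sum>a<m. p i a * y a) = v i" if "i < n" for i using that by (simp add: mult.commute)
  define Y where "Y = (\<Sum>a<m. (y a)\<^sup>2)"
  have "Y \<noteq> 0"
  proof
    assume "Y = 0"
    then have "y a = 0" if "a < m" for a using that by (simp add: Y_def sum_nonneg_eq_0_iff)
    then have "v k = 0" using y[OF kl(1)] by simp
    then show False by (simp add: v_def)
  qed
  then have Y: "Y > 0" by (simp add: Y_def sum_nonneg less_le)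
  define u where "u = (\<lambda>i. if i = k then 1 else if i = l then c else 0)"
  define q where "q = (\<lambda>i a. if a < m then p i a - v i / Y * y a else u i / sqrt Y)"
  have dot: "(\<Sum>a<Suc m. q i a * q j a) = (\<Sum>a<m. p i a * p j a) + (u i * u j - v i * v j) / Y"
    if "i < n" "j < n" for i j
  proof -
    have "(\<Sum>a<m. q i a * q j a) = (\<Sum>a<m. p i a * p j a - v j / Y * (p i a * y a)
        - v i / Y * (p j a * y a) + v i / Y * (v j / Y) * (y a)\<^sup>2)"
      by (intro sum.cong refl) (simp add: q_def power2_eq_square algebra_simps)
    also have "\<dots> = (\<Sum>a<m. p i a * p j a) - v j / Y * v i - v i / Y * v j + v i / Y * (v j / Y) * Y"
      by (simp only: sum.distrib sum_subtractf sum_distrib_left[symmetric] y that Y_def)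
    also have "\<dots> = (\<Sum>a<m. p i a * p j a) - v i * v j / Y" using Y by simp
    finally have "(\<Sum>a<m. q i a * q j a) = (\<Sum>a<m. p i a * p j a) - v i * v j / Y" .
    moreover have "q i m * q j m = u i * u j / Y" using Y by (simp add: q_def)
    ultimately show ?thesis by (simp add: diff_divide_distrib)
  qed
  have q1: "(\<Sum>a<Suc m. (q i a)\<^sup>2) = 1" if "i < n" for i
  proof -
    \<comment> \<open>\<open>u\<close> and \<open>v\<close> agree up to sign in each entry, so the
      diagonal of the Gram matrix does not change.\<close>
    have "u i * u i = v i * v i" by (simp add: u_def v_def)
    then show ?thesis using dot[OF that that] unit[OF that] by (simp add: power2_eq_square)
  qed
  have dist: "(\<Sum>a<M. (g i a - g j a)\<^sup>2) =
      (\<Sum>a<M. (g i a)\<^sup>2) + (\<Sum>a<M. (g j a)\<^sup>2) - 2 * (\<Sum>a<M. g i a * g j a)"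
    for g :: "nat \<Rightarrow> nat \<Rightarrow> real" and M i j
    by (simp add: power2_diff sum.distrib sum_subtractf sum_distrib_left algebra_simps)
  \<comment> \<open>The squared distance of unit vectors is 2 minus twice their inner product, so
    the off-diagonal Gram change \<open>2 * c / Y\<close> becomes
    \<open>- 4 * c / Y\<close>.\<close>
  have "(\<Sum>a<Suc m. (q i a - q j a)\<^sup>2) = (\<Sum>a<m. (p i a - p j a)\<^sup>2)
    + (if (i, j) = (k, l) \<or> (i, j) = (l, k) then - 4 * c / Y else 0)" if "i < n" "j < n" for i j
  proof -
    have "2 * ((u i * u j - v i * v j) / Y) =
      - (if (i, j) = (k, l) \<or> (i, j) = (l, k) then - 4 * c / Y else 0)"
      using kl by (auto simp: u_def v_def)
    then show ?thesis unfolding dist q1[OF that(1)] q1[OF that(2)] unit[OF that(1)] unit[OF that(2)]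
        dot[OF that] by simp
  qed
  moreover have "- 4 * c / Y \<noteq> 0" using Y \<open>c \<noteq> 0\<close> by simp
  ultimately show ?thesis using q1 by blast
qed

subsection \<open>Euclidean distance matrices and affine spans\<close>

text \<open>Names the matrix whose rank is \<open>affine_span_dim\<close>. For a nonempty
  configuration its column 0 is zero.\<close>

definition difference_mat :: "real mat \<Rightarrow> real mat" where
  "difference_mat P =
     mat_of_cols (dim_col P) (map (\<lambda>i. row P i - row P 0) [0..<dim_row P])"

lemma difference_mat_carrier:
  "P \<in> carrier_mat n m \<Longrightarrow> difference_mat P \<in> carrier_mat m n"
  by (auto simp: difference_mat_def mat_of_cols_def)

lemma difference_mat_index:
  assumes "P \<in> carrier_mat n m" "i < n" "a < m"
  shows "difference_mat P $$ (a, i) = P $$ (i, a) - P $$ (0, a)"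
  using assms by (auto simp: difference_mat_def mat_of_cols_def)

lemma difference_mat_mult_vec:
  assumes P: "P \<in> carrier_mat n m" and x: "x \<in> carrier_vec n" and a: "a < m"
  shows "(difference_mat P *\<^sub>v x) $ a = (\<Sum>i<n. x $ i * (P $$ (i, a) - P $$ (0, a)))"
  using difference_mat_carrier[OF P] difference_mat_index[OF P _ a] x a
  by (auto simp: scalar_prod_def atLeast0LessThan mult.commute intro!: sum.cong)

lemma affine_span_dim_eq_rank:
  "P \<in> carrier_mat n m \<Longrightarrow> affine_span_dim P = vec_space.rank m (difference_mat P)"
  by (simp add: affine_span_dim_def difference_mat_def)

lemma eucl_norm_sq:
  assumes "v \<in> carrier_vec m"
  shows "(eucl_norm v)\<^sup>2 = (\<Sum>a<m. (v $ a)\<^sup>2)"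
  using assms
  by (simp add: eucl_norm_def scalar_prod_def atLeast0LessThan power2_eq_square sum_nonneg)

lemma eucl_norm_nonneg: "0 \<le> eucl_norm v"
  by (simp add: eucl_norm_def scalar_prod_def sum_nonneg)

lemma generates_iff:
  assumes "P \<in> carrier_mat n m"
  shows "generates P D \<longleftrightarrow> D \<in> carrier_mat n n \<and>
    (\<forall>i<n. \<forall>j<n. D $$ (i, j) = (\<Sum>a<m. (P $$ (i, a) - P $$ (j, a))\<^sup>2))"
proof -
  have "(eucl_norm (row P i - row P j))\<^sup>2 = (\<Sum>a<m. (P $$ (i, a) - P $$ (j, a))\<^sup>2)"
    if "i < n" "j < n" for i j
    using assms that by (subst eucl_norm_sq[of _ m]) (auto intro!: sum.cong)
  then show ?thesis using assms by (auto simp: generates_def)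
qed

text \<open>By \<open>sum_mult_sq_dist\<close> the form is minus twice the squared norm of the
  vector \<open>x\<close> produces from the points. On sum-zero vectors the kernel thus depends on
  \<open>D\<close> alone, which allows one set of generating points to be exchanged for
  another.\<close>

lemma kernel_iff_quadratic_form:
  fixes x :: "nat \<Rightarrow> real" and p :: "nat \<Rightarrow> nat \<Rightarrow> real"
  assumes D: "\<And>i j. i < n \<Longrightarrow> j < n \<Longrightarrow> D $$ (i, j) = (\<Sum>a<m. (p i a - p j a)\<^sup>2)"
    and x: "(\<Sum>i<n. x i) = 0"
  shows "(\<forall>a<m. (\<Sum>i<n. x i * p i a) = 0) \<longleftrightarrow> (\<Sum>i<n. \<Sum>j<n. x i * x j * D $$ (i, j)) = 0"
proof -
  have "(\<Sum>i<n. \<Sum>j<n. x i * x j * D $$ (i, j)) =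
      (\<Sum>i<n. \<Sum>j<n. x i * x j * (\<Sum>a<m. (p i a - p j a)\<^sup>2))"
    by (intro sum.cong refl) (simp add: D)
  also have "\<dots> = - 2 * (\<Sum>a<m. (\<Sum>i<n. x i * p i a)\<^sup>2)"
    unfolding sum_mult_sq_dist x by simp
  finally show ?thesis by (simp add: sum_nonneg_eq_0_iff Ball_def)
qed

text \<open>Subtracting p^0 from every point amounts to correcting entry 0 of \<open>x\<close> so
  that the entries sum to 0.\<close>

lemma difference_mat_kernel_iff:
  assumes P: "P \<in> carrier_mat n m" "generates P D" and n: "0 < n" and x: "x \<in> carrier_vec n"
  defines "y \<equiv> \<lambda>i. x $ i - (if i = 0 then (\<Sum>j<n. x $ j) else 0)"
  shows "difference_mat P *\<^sub>v x = 0\<^sub>v m \<longleftrightarrow> (\<Sum>i<n. \<Sum>j<n. y i * y j * D $$ (i, j)) = 0"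
proof -
  have y0: "(\<Sum>i<n. y i) = 0" using n by (simp add: y_def sum_subtractf)
  have "(difference_mat P *\<^sub>v x) $ a = (\<Sum>i<n. y i * P $$ (i, a))" if "a < m" for a
  proof -
    have "(\<Sum>i<n. y i * P $$ (i, a)) =
      (\<Sum>i<n. x $ i * P $$ (i, a) - (if i = 0 then (\<Sum>j<n. x $ j) * P $$ (0, a) else 0))"
      by (intro sum.cong refl) (auto simp: y_def algebra_simps)
    also have "\<dots> = (\<Sum>i<n. x $ i * P $$ (i, a)) - (\<Sum>j<n. x $ j) * P $$ (0, a)"
      using n by (simp add: sum_subtractf)
    also have "\<dots> = (difference_mat P *\<^sub>v x) $ a"
      unfolding difference_mat_mult_vec[OF P(1) x that]
      by (simp add: sum_subtractf sum_distrib_right right_diff_distrib)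
    finally show ?thesis ..
  qed
  then have "difference_mat P *\<^sub>v x = 0\<^sub>v m \<longleftrightarrow> (\<forall>a<m. (\<Sum>i<n. y i * P $$ (i, a)) = 0)"
    using difference_mat_carrier[OF P(1)] by (auto simp: vec_eq_iff)
  also have "\<dots> \<longleftrightarrow> (\<Sum>i<n. \<Sum>j<n. y i * y j * D $$ (i, j)) = 0"
    by (rule kernel_iff_quadratic_form[OF _ y0]) (use P generates_iff in auto)
  finally show ?thesis .
qed

text \<open>The two difference matrices have the same kernel and the same number of columns, hence
  the same rank.\<close>

lemma affine_span_dim_unique:
  assumes "P \<in> carrier_mat n m" "generates P D" "Q \<in> carrier_mat n m'" "generates Q D" "0 < n"
  shows "affine_span_dim P = affine_span_dim Q"
proof -
  have "{x \<in> carrier_vec n. difference_mat P *\<^sub>v x = 0\<^sub>v m} =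
    {x \<in> carrier_vec n. difference_mat Q *\<^sub>v x = 0\<^sub>v m'}"
    using difference_mat_kernel_iff assms by blast
  then show ?thesis
    using vec_space.rank_nullity_mat[OF difference_mat_carrier[OF assms(1)]]
      vec_space.rank_nullity_mat[OF difference_mat_carrier[OF assms(3)]]
    unfolding affine_span_dim_eq_rank[OF assms(1)] affine_span_dim_eq_rank[OF assms(3)]
    by simp
qed

lemma affine_span_dim_eq_dim_imp_surj:
  fixes b :: "nat \<Rightarrow> real"
  assumes P: "P \<in> carrier_mat n m" and full: "affine_span_dim P = m"
  shows "\<exists>x. \<forall>a<m. (\<Sum>i<n. x i * (P $$ (i, a) - P $$ (0, a))) = b a"
proof -
  obtain x where x: "x \<in> carrier_vec n" "difference_mat P *\<^sub>v x = vec m b"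
    using full vec_space.rank_eq_dim_iff_surj[OF difference_mat_carrier[OF P]]
    unfolding affine_span_dim_eq_rank[OF P] by (meson vec_carrier)
  then have "(\<Sum>i<n. x $ i * (P $$ (i, a) - P $$ (0, a))) = b a" if "a < m" for a
    using difference_mat_mult_vec[OF P x(1) that] that by simp
  then show ?thesis by blast
qed

text \<open>If only 0 is orthogonal to all differences, they span; this is
  \<open>functional_in_span\<close> with the roles of points and coordinates exchanged.\<close>

lemma affine_span_dim_eq_dimI:
  assumes P: "P \<in> carrier_mat n m"
    and inj: "\<And>y a. (\<And>i. i < n \<Longrightarrow> (\<Sum>a<m. (P $$ (i, a) - P $$ (0, a)) * y a) = 0) \<Longrightarrow> a < m \<Longrightarrow> y a = 0"
  shows "affine_span_dim P = m"
proof -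
  have "\<exists>x \<in> carrier_vec n. difference_mat P *\<^sub>v x = b" if b: "b \<in> carrier_vec m" for b
  proof -
    have "(\<Sum>a<m. b $ a * y a) = 0"
      if "\<And>i. i < n \<Longrightarrow> (\<Sum>a<m. (P $$ (i, a) - P $$ (0, a)) * y a) = 0" for y
      using inj[OF that] by simp
    then obtain x where x: "\<forall>a<m. b $ a = (\<Sum>i<n. x i * (P $$ (i, a) - P $$ (0, a)))"
      using functional_in_span[where m = n and n = m and v = "\<lambda>a. b $ a"
          and f = "\<lambda>i a. P $$ (i, a) - P $$ (0, a)"] by blast
    have "difference_mat P *\<^sub>v vec n x = b"
      using x b difference_mat_carrier[OF P]
      by (intro eq_vecI) (auto simp: difference_mat_mult_vec[OF P] simp del: index_mult_mat_vec)
    then show ?thesis by (metis vec_carrier)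
  qed
  then show ?thesis
    using vec_space.rank_eq_dim_iff_surj[OF difference_mat_carrier[OF P]]
    unfolding affine_span_dim_eq_rank[OF P] by blast
qed

text \<open>Deleting the zero column 0 leaves \<open>M\<close>, with \<open>n - 1\<close> columns
  and the same column space. Rank \<open>n - 1\<close> makes \<open>M\<close> injective, and a
  sum-zero vector is determined by its entries from 1 on.\<close>

lemma affine_span_dim_bound:
  assumes P: "P \<in> carrier_mat n m" and n: "0 < n"
  shows "affine_span_dim P \<le> n - 1"
    and "affine_span_dim P = n - 1 \<Longrightarrow> (\<Sum>i<n. x i) = 0 \<Longrightarrow>
      (\<And>a. a < m \<Longrightarrow> (\<Sum>i<n. x i * P $$ (i, a)) = 0) \<Longrightarrow> i < n \<Longrightarrow> x i = 0"
proof -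
  interpret vec_space "TYPE(real)" m .
  define M where "M = mat m (n - 1) (\<lambda>(a, i). P $$ (Suc i, a) - P $$ (0, a))"
  have M: "M \<in> carrier_mat m (n - 1)" by (simp add: M_def)
  obtain n' where n': "n = Suc n'" using n gr0_conv_Suc by auto
  have Mx: "(M *\<^sub>v y) $ a = (\<Sum>i<n'. y $ i * (P $$ (Suc i, a) - P $$ (0, a)))"
    if "y \<in> carrier_vec n'" "a < m" for y a
    using that by (auto simp: M_def n' scalar_prod_def atLeast0LessThan mult.commute intro!: sum.cong)
  have Dx: "(difference_mat P *\<^sub>v z) $ a = (\<Sum>i<n'. z $ Suc i * (P $$ (Suc i, a) - P $$ (0, a)))"
    if "z \<in> carrier_vec n" "a < m" for z a
    using difference_mat_mult_vec[OF P that] unfolding n' sum.lessThan_Suc_shift by simp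
  have "{y \<in> carrier_vec m. \<exists>x \<in> carrier_vec n. difference_mat P *\<^sub>v x = y} =
    {y \<in> carrier_vec m. \<exists>x \<in> carrier_vec (n - 1). M *\<^sub>v x = y}"
  proof (intro Collect_cong conj_cong refl iffI)
    fix y assume "y \<in> carrier_vec m" "\<exists>x \<in> carrier_vec n. difference_mat P *\<^sub>v x = y"
    then obtain x where x: "x \<in> carrier_vec n" "difference_mat P *\<^sub>v x = y" by blast
    have "M *\<^sub>v vec (n - 1) (\<lambda>i. x $ Suc i) = difference_mat P *\<^sub>v x"
      using M difference_mat_carrier[OF P] x
      by (intro eq_vecI) (auto simp: Mx Dx n' simp del: index_mult_mat_vec)
    then show "\<exists>x \<in> carrier_vec (n - 1). M *\<^sub>v x = y" using x by (metis vec_carrier)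
  next
    fix y assume "y \<in> carrier_vec m" "\<exists>x \<in> carrier_vec (n - 1). M *\<^sub>v x = y"
    then obtain x where x: "x \<in> carrier_vec (n - 1)" "M *\<^sub>v x = y" by blast
    \<comment> \<open>At index 0 truncated subtraction gives an irrelevant entry, since it meets the
      zero column.\<close>
    have "difference_mat P *\<^sub>v vec n (\<lambda>i. x $ (i - 1)) = M *\<^sub>v x"
      using M difference_mat_carrier[OF P] x
      by (intro eq_vecI) (auto simp: Mx Dx n' simp del: index_mult_mat_vec)
    then show "\<exists>x \<in> carrier_vec n. difference_mat P *\<^sub>v x = y" using x by (metis vec_carrier)
  qed
  then have "col_space (difference_mat P) = col_space M"
    using col_space_eq[OF difference_mat_carrier[OF P]] col_space_eq[OF M]
      difference_mat_carrier[OF P] M by simp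
  then have r: "affine_span_dim P = rank M"
    unfolding affine_span_dim_eq_rank[OF P] rank_def col_space_def by simp
  then show "affine_span_dim P \<le> n - 1" using rank_le_nc[OF M] by simp
  assume full: "affine_span_dim P = n - 1" and x0: "(\<Sum>i<n. x i) = 0" and i: "i < n"
    and xP: "\<And>a. a < m \<Longrightarrow> (\<Sum>i<n. x i * P $$ (i, a)) = 0"
  have "M *\<^sub>v vec (n - 1) (\<lambda>i. x (Suc i)) = 0\<^sub>v m"
  proof (rule eq_vecI)
    fix a assume "a < dim_vec (0\<^sub>v m :: real vec)"
    then have a: "a < m" by simp
    have "(M *\<^sub>v vec (n - 1) (\<lambda>i. x (Suc i))) $ a =
        (\<Sum>i<n'. x (Suc i) * (P $$ (Suc i, a) - P $$ (0, a)))"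
      using a by (simp add: Mx n' del: index_mult_mat_vec)
    also have "\<dots> = (\<Sum>i<n. x i * P $$ (i, a)) - (\<Sum>i<n. x i) * P $$ (0, a)"
      unfolding n' sum.lessThan_Suc_shift
      by (simp add: sum_subtractf sum_distrib_left algebra_simps)
    finally show "(M *\<^sub>v vec (n - 1) (\<lambda>i. x (Suc i))) $ a = 0\<^sub>v m $ a"
      using x0 xP a by simp
  qed (use M in simp)
  then have "vec (n - 1) (\<lambda>i. x (Suc i)) = 0\<^sub>v (n - 1)"
    using rank_eq_nc_imp_kernel[OF M] r full by simp
  then have s: "x (Suc j) = 0" if "j < n'" for j
    using that by (auto simp: vec_eq_iff n')
  then have "x 0 = 0" using x0 unfolding n' sum.lessThan_Suc_shift by simp
  then show "x i = 0" using s i by (cases i) (auto simp: n')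
qed

section \<open>Spherical configurations and their dimension\<close>

lemma spherical_edmE:
  assumes "spherical_edm n D \<rho>" "0 < n"
  obtains P c r where "embedding_dim n D r" "P \<in> carrier_mat n r" "generates P D" "0 \<le> \<rho>"
    "\<And>i. i < n \<Longrightarrow> (\<Sum>a<r. (P $$ (i, a) - c $ a)\<^sup>2) = \<rho>\<^sup>2"
proof -
  obtain r P c where *: "embedding_dim n D r" "P \<in> carrier_mat n r" "c \<in> carrier_vec r"
      "generates P D" "\<forall>i<n. eucl_norm (row P i - c) = \<rho>"
    using assms(1) unfolding spherical_edm_def by blast
  have "(\<Sum>a<r. (P $$ (i, a) - c $ a)\<^sup>2) = \<rho>\<^sup>2" if "i < n" for i
  proof -
    have "(eucl_norm (row P i - c))\<^sup>2 = (\<Sum>a<r. (P $$ (i, a) - c $ a)\<^sup>2)"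
      using * that by (subst eucl_norm_sq[of _ r]) (auto intro!: sum.cong)
    then show ?thesis using * that by simp
  qed
  moreover have "0 \<le> \<rho>" using *(5) assms(2) eucl_norm_nonneg by metis
  ultimately show ?thesis using that * by blast
qed

text \<open>As long as the points do not affinely span their space, a reflection makes the last
  coordinate constant and dropping it can only shrink the radius.\<close>

lemma spherical_edm_of_configuration:
  fixes p :: "nat \<Rightarrow> nat \<Rightarrow> real"
  assumes "D \<in> carrier_mat n n" "0 < n"
    and "\<And>i j. i < n \<Longrightarrow> j < n \<Longrightarrow> D $$ (i, j) = (\<Sum>a<m. (p i a - p j a)\<^sup>2)"
    and "\<And>i. i < n \<Longrightarrow> (\<Sum>a<m. (p i a - c a)\<^sup>2) = s" and "s \<le> 1"
  shows "\<exists>\<rho>\<le>1. spherical_edm n D \<rho>"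
  using assms(3-)
proof (induction m arbitrary: p c s rule: less_induct)
  case (less m)
  define P where "P = mat n m (\<lambda>(i, a). p i a)"
  have P: "P \<in> carrier_mat n m" "generates P D"
    using less.prems(1) assms(1) by (auto simp: P_def generates_iff[of _ n m])
  show ?case
  proof (cases "\<exists>y. (\<forall>i<n. (\<Sum>a<m. (p i a - p 0 a) * y a) = 0) \<and> (\<exists>a<m. y a \<noteq> 0)")
    case False
    \<comment> \<open>No nonzero vector is orthogonal to all differences, so \<open>m\<close> is
      already the embedding dimension.\<close>
    have "affine_span_dim P = m"
      by (rule affine_span_dim_eq_dimI[OF P(1)])
        (use False assms(2) in \<open>auto simp: P_def\<close>)
    then have "embedding_dim n D m" unfolding embedding_dim_def using P by blast
    moreover have "eucl_norm (row P i - vec m c) = sqrt s" if "i < n" for i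
    proof -
      have "(eucl_norm (row P i - vec m c))\<^sup>2 = (\<Sum>a<m. (p i a - c a)\<^sup>2)"
        using that P by (subst eucl_norm_sq[of _ m]) (auto simp: P_def intro!: sum.cong)
      then show ?thesis
        using less.prems(2)[OF that] eucl_norm_nonneg real_sqrt_unique by metis
    qed
    ultimately have "spherical_edm n D (sqrt s)"
      unfolding spherical_edm_def using P by (meson vec_carrier)
    then show ?thesis using \<open>s \<le> 1\<close> by (auto intro!: exI[of _ "sqrt s"])
  next
    case True
    then obtain y0 a0 where y0: "\<And>i. i < n \<Longrightarrow> (\<Sum>a<m. (p i a - p 0 a) * y0 a) = 0"
      and a0: "a0 < m" "y0 a0 \<noteq> 0" by blast
    obtain m' where m': "m = Suc m'" using a0 less_imp_Suc_add by blast
    define Y where "Y = (\<Sum>a<m. (y0 a)\<^sup>2)"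
    have "Y \<noteq> 0" using a0 by (auto simp: Y_def sum_nonneg_eq_0_iff)
    then have Y: "Y > 0" by (simp add: Y_def sum_nonneg less_le)
    \<comment> \<open>The sign makes the last coordinate of the unit normal \<open>y\<close>
      nonnegative, as the reflection requires.\<close>
    define e where "e = (if y0 m' \<ge> 0 then 1 else - 1 :: real)"
    define y where "y = (\<lambda>a. e / sqrt Y * y0 a)"
    have e: "e\<^sup>2 = 1" by (simp add: e_def)
    have unit: "(\<Sum>a<m. (y a)\<^sup>2) = 1"
      using Y by (simp add: y_def power_mult_distrib power_divide e sum_divide_distrib[symmetric] Y_def[symmetric])
    have ynn: "y m' \<ge> 0" using Y by (simp add: y_def e_def mult_nonneg_nonneg)
    have orth: "(\<Sum>a<m. y a * (p i a - p 0 a)) = 0" if "i < n" for i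
    proof -
      have "(\<Sum>a<m. y a * (p i a - p 0 a)) = e / sqrt Y * (\<Sum>a<m. (p i a - p 0 a) * y0 a)"
        by (simp add: y_def sum_distrib_left mult_ac)
      then show ?thesis using y0[OF that] by simp
    qed
    define h where "h = (\<lambda>z a. z a - ((\<Sum>b<m. y b * z b) + z m') / (1 + y m') * y a)"
    have h_diff: "h z a - h z' a = h (\<lambda>a. z a - z' a) a" for z z' :: "nat \<Rightarrow> real" and a
      by (simp add: h_def sum_subtractf right_diff_distrib diff_divide_distrib add_divide_distrib algebra_simps)
    have h_sq: "(\<Sum>a<m'. (h z a)\<^sup>2) = (\<Sum>a<m. (z a)\<^sup>2) - (\<Sum>a<m. y a * z a)\<^sup>2" for z
      using sum_sq_householder[OF unit[unfolded m'] ynn, of z] unfolding h_def m' .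
    have const: "(\<Sum>a<m. y a * (p i a - w a)) = (\<Sum>a<m. y a * (p 0 a - w a))" if "i < n" for i w
      using orth[OF that] by (simp add: sum_subtractf right_diff_distrib)
    show ?thesis
    \<comment> \<open>\<open>y\<close> has the same inner product with \<open>p i - c\<close> for
      every \<open>i\<close>, so all squared distances to the center drop by the same
      square.\<close>
    proof (rule less.IH[of m' "\<lambda>i. h (p i)" "h c" "s - (\<Sum>a<m. y a * (p 0 a - c a))\<^sup>2"])
      show "m' < m" by (simp add: m')
      show "D $$ (i, j) = (\<Sum>a<m'. (h (p i) a - h (p j) a)\<^sup>2)" if "i < n" "j < n" for i j
        using less.prems(1)[OF that] const[OF that(1), of "p j"] orth[OF that(2)]
        by (simp add: h_diff h_sq) (simp add: sum_subtractf right_diff_distrib)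
      show "(\<Sum>a<m'. (h (p i) a - h c a)\<^sup>2) = s - (\<Sum>a<m. y a * (p 0 a - c a))\<^sup>2" if "i < n" for i
        using less.prems(2)[OF that] const[OF that, of c] by (simp add: h_diff h_sq)
      show "s - (\<Sum>a<m. y a * (p 0 a - c a))\<^sup>2 \<le> 1"
        using \<open>s \<le> 1\<close> zero_le_power2[of "\<Sum>a<m. y a * (p 0 a - c a)"] by linarith
    qed
  qed
qed

subsection \<open>Perturbing one entry\<close>

lemma quadratic_form_sym_unit_mat:
  fixes x :: "nat \<Rightarrow> real"
  assumes "k < n" "l < n" "k \<noteq> l"
  shows "(\<Sum>i<n. \<Sum>j<n. x i * x j * sym_unit_mat n k l $$ (i, j)) = 2 * x k * x l"
proof -
  have "(\<Sum>j<n. x i * x j * sym_unit_mat n k l $$ (i, j)) =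
      (if i = k then x k * x l else 0) + (if i = l then x k * x l else 0)" if "i < n" for i
  proof -
    have "(\<Sum>j<n. x i * x j * sym_unit_mat n k l $$ (i, j)) =
      (\<Sum>j<n. (if j = l then (if i = k then x k * x l else 0) else 0)
        + (if j = k then (if i = l then x k * x l else 0) else 0))"
      using that assms by (intro sum.cong refl) (auto simp: sym_unit_mat_def)
    then show ?thesis using assms by (simp add: sum.distrib)
  qed
  then have "(\<Sum>i<n. \<Sum>j<n. x i * x j * sym_unit_mat n k l $$ (i, j)) =
      (\<Sum>i<n. (if i = k then x k * x l else 0) + (if i = l then x k * x l else 0))"
    by simp
  then show ?thesis using assms by (simp add: sum.distrib)
qed

text \<open>A nonzero member forces proportionality on the kernel, and proportionality yields a unit
  configuration for some nonzero \<open>t\<close>. The configuration \<open>p\<close> itself shows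
  that 0 is a member.\<close>

lemma T_le_trivial_iff:
  fixes p :: "nat \<Rightarrow> nat \<Rightarrow> real"
  assumes D: "D \<in> carrier_mat n n" "\<And>i j. i < n \<Longrightarrow> j < n \<Longrightarrow> D $$ (i, j) = (\<Sum>a<m. (p i a - p j a)\<^sup>2)"
    and unit: "\<And>i. i < n \<Longrightarrow> (\<Sum>a<m. (p i a)\<^sup>2) = 1"
    and kl: "k < n" "l < n" "k \<noteq> l"
  shows "T_le n D k l = {0} \<longleftrightarrow>
    \<not> (\<exists>c. c \<noteq> 0 \<and> (\<forall>x. (\<forall>a<m. (\<Sum>i<n. x i * p i a) = 0) \<longrightarrow> x k = c * x l))"
proof -
  have n: "0 < n" using kl by simp
  let ?D = "\<lambda>t. D + t \<cdot>\<^sub>m sym_unit_mat n k l"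
  have Dt: "?D t \<in> carrier_mat n n" for t using D(1) by (auto simp: sym_unit_mat_def)
  have Dt_ij: "?D t $$ (i, j) = D $$ (i, j) + t * sym_unit_mat n k l $$ (i, j)"
    if "i < n" "j < n" for i j t
    using that D(1) by (auto simp: sym_unit_mat_def)
  \<comment> \<open>The quadratic form of the perturbed matrix is bounded through a configuration of
    radius at most 1 and computed exactly through \<open>p\<close>.\<close>
  have psd: "t * x k * x l \<le> (\<Sum>a<m. (\<Sum>i<n. x i * p i a)\<^sup>2)" if t: "t \<in> T_le n D k l" for t x
  proof -
    obtain \<rho> where \<rho>: "\<rho> \<le> 1" "spherical_edm n (?D t) \<rho>" using t by (auto simp: T_le_def)
    from spherical_edmE[OF \<rho>(2) n] obtain Q c r where Q: "Q \<in> carrier_mat n r" "generates Q (?D t)"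
      and "0 \<le> \<rho>" and sph: "\<And>i. i < n \<Longrightarrow> (\<Sum>a<r. (Q $$ (i, a) - c $ a)\<^sup>2) = \<rho>\<^sup>2" by metis
    have "\<rho>\<^sup>2 \<le> 1" using \<open>0 \<le> \<rho>\<close> \<rho>(1) by (simp add: power_le_one)
    define q where "q = (\<lambda>i a. Q $$ (i, a) - c $ a)"
    have "(\<Sum>i<n. \<Sum>j<n. x i * x j * ?D t $$ (i, j)) =
      (\<Sum>i<n. \<Sum>j<n. x i * x j * (\<Sum>a<r. (q i a - q j a)\<^sup>2))"
      using Q(2) unfolding generates_iff[OF Q(1)] by (intro sum.cong refl) (simp add: q_def)
    also have "\<dots> = 2 * (\<Sum>i<n. x i)\<^sup>2 * \<rho>\<^sup>2 - 2 * (\<Sum>a<r. (\<Sum>i<n. x i * q i a)\<^sup>2)"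
      unfolding sum_mult_sq_dist
      using sph by (simp add: q_def sum_distrib_right[symmetric] power2_eq_square)
    also have "\<dots> \<le> 2 * (\<Sum>i<n. x i)\<^sup>2"
      using mult_left_mono[OF \<open>\<rho>\<^sup>2 \<le> 1\<close>, of "2 * (\<Sum>i<n. x i)\<^sup>2"]
        sum_nonneg[of "{..<r}" "\<lambda>a. (\<Sum>i<n. x i * q i a)\<^sup>2"] by simp
    finally have "(\<Sum>i<n. \<Sum>j<n. x i * x j * ?D t $$ (i, j)) \<le> 2 * (\<Sum>i<n. x i)\<^sup>2" .
    moreover have "(\<Sum>i<n. \<Sum>j<n. x i * x j * ?D t $$ (i, j)) =
      (\<Sum>i<n. \<Sum>j<n. x i * x j * (\<Sum>a<m. (p i a - p j a)\<^sup>2)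
        + t * (x i * x j * sym_unit_mat n k l $$ (i, j)))"
      using D(2) by (intro sum.cong refl) (simp add: Dt_ij algebra_simps del: index_add_mat index_smult_mat)
    moreover have "\<dots> = 2 * (\<Sum>i<n. x i)\<^sup>2 - 2 * (\<Sum>a<m. (\<Sum>i<n. x i * p i a)\<^sup>2) + t * (2 * x k * x l)"
      unfolding sum.distrib sum_distrib_left[symmetric] sum_mult_sq_dist
        quadratic_form_sym_unit_mat[OF kl]
      using unit by (simp add: power2_eq_square)
    ultimately show ?thesis by (simp add: algebra_simps)
  qed
  have "?D 0 = D" using D(1) by (intro eq_matI) (auto simp: sym_unit_mat_def)
  moreover have "\<exists>\<rho>\<le>1. spherical_edm n D \<rho>"
    by (rule spherical_edm_of_configuration[where p = p and m = m and s = 1 and c = "\<lambda>_. 0"])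
      (use D n unit in auto)
  ultimately have zero: "0 \<in> T_le n D k l" by (simp add: T_le_def)
  show ?thesis
  proof
    assume T: "T_le n D k l = {0}"
    show "\<not> (\<exists>c. c \<noteq> 0 \<and> (\<forall>x. (\<forall>a<m. (\<Sum>i<n. x i * p i a) = 0) \<longrightarrow> x k = c * x l))"
    proof
      assume "\<exists>c. c \<noteq> 0 \<and> (\<forall>x. (\<forall>a<m. (\<Sum>i<n. x i * p i a) = 0) \<longrightarrow> x k = c * x l)"
      then obtain c where c: "c \<noteq> 0"
        "\<And>x. (\<And>a. a < m \<Longrightarrow> (\<Sum>i<n. x i * p i a) = 0) \<Longrightarrow> x k = c * x l" by blast
      obtain q t where t: "t \<noteq> 0" and q: "\<forall>i<n. (\<Sum>a<Suc m. (q i a)\<^sup>2) = 1"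
        "\<forall>i<n. \<forall>j<n. (\<Sum>a<Suc m. (q i a - q j a)\<^sup>2) =
           (\<Sum>a<m. (p i a - p j a)\<^sup>2) + (if (i, j) = (k, l) \<or> (i, j) = (l, k) then t else 0)"
        using proportional_imp_unit_configuration[where p = p and m = m, OF kl c(1) unit c(2)] by blast
      have "\<exists>\<rho>\<le>1. spherical_edm n (?D t) \<rho>"
      proof (rule spherical_edm_of_configuration[OF Dt n, where p = q and m = "Suc m" and s = 1 and c = "\<lambda>_. 0"])
        show "?D t $$ (i, j) = (\<Sum>a<Suc m. (q i a - q j a)\<^sup>2)" if "i < n" "j < n" for i j
          unfolding Dt_ij[OF that] q(2)[rule_format, OF that] D(2)[OF that]
          using that by (simp add: sym_unit_mat_def)
      qed (use q(1) in auto)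
      then have "t \<in> T_le n D k l" by (simp add: T_le_def)
      then show False using T t by simp
    qed
  next
    assume "\<not> (\<exists>c. c \<noteq> 0 \<and> (\<forall>x. (\<forall>a<m. (\<Sum>i<n. x i * p i a) = 0) \<longrightarrow> x k = c * x l))"
    then have "t = 0" if "t \<in> T_le n D k l" for t
      using psd_perturbation_imp_proportional[OF kl _ psd[OF that]] by blast
    then show "T_le n D k l = {0}" using zero by blast
  qed
qed

section \<open>Gale space and proportional rows\<close>

lemma row_mat_of_cols_eq_smult_iff:
  assumes "k < n" "l < n"
  shows "row (mat_of_cols n vs) k = c \<cdot>\<^sub>v row (mat_of_cols n vs) l \<longleftrightarrow> (\<forall>v \<in> set vs. v $ k = c * v $ l)"
proof -
  have "row (mat_of_cols n vs) k = c \<cdot>\<^sub>v row (mat_of_cols n vs) l \<longleftrightarrow>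
    (\<forall>j<length vs. vs ! j $ k = c * vs ! j $ l)"
    using assms by (auto simp: vec_eq_iff mat_of_cols_index)
  also have "\<dots> \<longleftrightarrow> (\<forall>v \<in> set vs. v $ k = c * v $ l)"
    by (metis in_set_conv_nth)
  finally show ?thesis .
qed

text \<open>On sum-zero vectors both kernel conditions say that the same quadratic form of
  \<open>D\<close> vanishes, so \<open>p\<close> may replace the points in \<open>P\<close>.\<close>

lemma gale_space_eq:
  fixes p :: "nat \<Rightarrow> nat \<Rightarrow> real"
  assumes P: "P \<in> carrier_mat n r" "generates P D"
    and D: "\<And>i j. i < n \<Longrightarrow> j < n \<Longrightarrow> D $$ (i, j) = (\<Sum>a<m. (p i a - p j a)\<^sup>2)"
  shows "gale_space n P =
    {x \<in> carrier_vec n. (\<Sum>i<n. x $ i) = 0 \<and> (\<forall>a<m. (\<Sum>i<n. x $ i * p i a) = 0)}"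
proof -
  have "x \<in> gale_space n P \<longleftrightarrow> (\<Sum>i<n. x $ i) = 0 \<and> (\<forall>a<m. (\<Sum>i<n. x $ i * p i a) = 0)"
    if x: "x \<in> carrier_vec n" for x
  proof -
    have "ones_vec n \<bullet> x = (\<Sum>i<n. x $ i)"
      using x by (simp add: ones_vec_def scalar_prod_def atLeast0LessThan)
    moreover have "transpose_mat P *\<^sub>v x = 0\<^sub>v r \<longleftrightarrow> (\<forall>a<r. (\<Sum>i<n. x $ i * P $$ (i, a)) = 0)"
      using x P(1) by (simp add: vec_eq_iff scalar_prod_def atLeast0LessThan mult.commute)
    moreover have "(\<forall>a<r. (\<Sum>i<n. x $ i * P $$ (i, a)) = 0) \<longleftrightarrow> (\<forall>a<m. (\<Sum>i<n. x $ i * p i a) = 0)"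
      if "(\<Sum>i<n. x $ i) = 0"
    proof -
      have "(\<forall>a<r. (\<Sum>i<n. x $ i * P $$ (i, a)) = 0) \<longleftrightarrow>
          (\<Sum>i<n. \<Sum>j<n. x $ i * x $ j * D $$ (i, j)) = 0"
        by (rule kernel_iff_quadratic_form[OF _ that]) (use P generates_iff in auto)
      also have "\<dots> \<longleftrightarrow> (\<forall>a<m. (\<Sum>i<n. x $ i * p i a) = 0)"
        by (rule kernel_iff_quadratic_form[OF D that, symmetric])
      finally show ?thesis .
    qed
    ultimately show ?thesis using x P(1) by (auto simp: gale_space_def)
  qed
  then show ?thesis by (auto simp: gale_space_def)
qed

lemma gale_space_submodule:
  assumes "P \<in> carrier_mat n r"
  shows "submodule class_ring (gale_space n P) (module_vec TYPE(real) n)"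
proof -
  interpret vec_space "TYPE(real)" n .
  have T: "transpose_mat P \<in> carrier_mat r n" using assms by simp
  have o: "ones_vec n \<in> carrier_vec n" by (simp add: ones_vec_def)
  show ?thesis
    using assms T o
    by unfold_locales
      (auto simp: gale_space_def mult_add_distrib_mat_vec[OF T] mult_mat_vec[OF T]
        scalar_prod_add_distrib[OF o])
qed

text \<open>The relation is linear in the vector, so it passes from a spanning set to the whole
  space.\<close>

lemma basis_gale_space_proportional_iff:
  assumes P: "P \<in> carrier_mat n r"
    and B: "vectorspace.basis class_ring
      (module_vec TYPE(real) n\<lparr>carrier := gale_space n P\<rparr>) B"
    and kl: "k < n" "l < n"
  shows "(\<forall>v \<in> B. v $ k = c * v $ l) \<longleftrightarrow> (\<forall>x \<in> gale_space n P. x $ k = c * x $ l)"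
proof -
  interpret vec_space "TYPE(real)" n .
  have sub: "submodule class_ring (gale_space n P) V" by (rule gale_space_submodule[OF P])
  interpret G: vectorspace class_ring "vs (gale_space n P)"
    by (rule subspace_is_vs) (use sub vec_vs in \<open>simp add: VectorSpace.subspace_def\<close>)
  have BG: "B \<subseteq> gale_space n P" and "G.span B = gale_space n P"
    using B unfolding G.basis_def by auto
  then have spB: "span B = gale_space n P"
    using span_li_not_depend(1)[OF BG sub] by simp
  have Bc: "B \<subseteq> carrier_vec n" using BG by (auto simp: gale_space_def)
  show ?thesis
  proof
    assume v: "\<forall>v \<in> B. v $ k = c * v $ l"
    show "\<forall>x \<in> gale_space n P. x $ k = c * x $ l"
    proof
      fix x assume "x \<in> gale_space n P"
      then obtain a A where A: "A \<subseteq> B" "x = lincomb a A"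
        unfolding spB[symmetric] span_def by auto
      have Ac: "A \<subseteq> carrier_vec n" using A Bc by blast
      show "x $ k = c * x $ l"
        unfolding A(2) lincomb_index[OF kl(1) Ac] lincomb_index[OF kl(2) Ac] sum_distrib_left
        using v A(1) by (intro sum.cong refl) (auto simp: mult.left_commute)
    qed
  qed (use BG in blast)
qed

theorem theorem3p1:
  fixes n r k l :: nat and D M Z :: "real mat" and w :: "real vec"
  assumes "spherical_edm n D 1"
    and "embedding_dim n D r"
    and "k < l" and "l < n"
    and "yielding n D k l"
    and "moore_penrose_inverse D M"
    and "w = M *\<^sub>v ones_vec n"
    and "r \<le> n - 2 \<Longrightarrow> gale_matrix n D r Z"
  shows "(T_le n D k l = {0} \<longleftrightarrow>
            \<not> parallel (row (Z_tilde n r w Z) k) (row (Z_tilde n r w Z) l)) \<and>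
         (T_le n D k l = {0} \<longleftrightarrow>
            \<not> (\<exists>c. c \<noteq> 0 \<and> w $ k = c * w $ l \<and>
                 (r \<le> n - 2 \<longrightarrow> row Z k = c \<cdot>\<^sub>v row Z l)))"
proof -
  have n: "0 < n" "2 \<le> n" and kl: "k < n" "l < n" "k \<noteq> l" using assms(3,4) by auto
  obtain P c m where emb: "embedding_dim n D m" and P: "P \<in> carrier_mat n m" "generates P D"
    and sph: "\<And>i. i < n \<Longrightarrow> (\<Sum>a<m. (P $$ (i, a) - c $ a)\<^sup>2) = 1"
    using spherical_edmE[OF assms(1) n(1)] by (metis one_power2)
  \<comment> \<open>The center of the sphere is moved to the origin.\<close>
  define p where "p = (\<lambda>i a. P $$ (i, a) - c $ a)"
  have D: "D \<in> carrier_mat n n" using P generates_iff by blast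
  have D_ij: "D $$ (i, j) = (\<Sum>a<m. (p i a - p j a)\<^sup>2)" if "i < n" "j < n" for i j
    using P that generates_iff[OF P(1)] by (simp add: p_def)
  have unit: "(\<Sum>a<m. (p i a)\<^sup>2) = 1" if "i < n" for i
    using sph[OF that] by (simp add: p_def)
  have D_sym: "D $$ (i, j) = D $$ (j, i)" if "i < n" "j < n" for i j
    using that by (simp add: D_ij power2_commute)
  let ?N = "\<lambda>x. \<forall>a<m. (\<Sum>i<n. x i * p i a) = 0"

  have D_row: "(\<Sum>j<n. D $$ (i, j) * x j) = 2 * (\<Sum>j<n. x j) - 2 * (\<Sum>a<m. p i a * (\<Sum>j<n. x j * p j a))"
    if "i < n" for x i
  proof -
    have D_ij': "D $$ (i, j) = 2 - 2 * (\<Sum>a<m. p i a * p j a)" if "j < n" for j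
      using unit[OF \<open>i < n\<close>] unit[OF that] unfolding D_ij[OF \<open>i < n\<close> that]
      by (simp add: power2_diff sum.distrib sum_subtractf sum_distrib_left[symmetric] mult.assoc)
    have D_ij_x: "D $$ (i, j) * x j = 2 * x j - 2 * (\<Sum>a<m. p i a * (x j * p j a))" if "j < n" for j
    proof -
      have "(\<Sum>a<m. p i a * (x j * p j a)) = (\<Sum>a<m. p i a * p j a) * x j"
        by (simp add: sum_distrib_left mult_ac)
      then show ?thesis
        using D_ij'[OF that] by (simp add: left_diff_distrib)
    qed
    have "(\<Sum>j<n. D $$ (i, j) * x j) = (\<Sum>j<n. 2 * x j - 2 * (\<Sum>a<m. p i a * (x j * p j a)))"
      using D_ij_x by simp
    also have "\<dots> = 2 * (\<Sum>j<n. x j) - 2 * (\<Sum>j<n. \<Sum>a<m. p i a * (x j * p j a))"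
      by (simp only: sum_subtractf sum_distrib_left[symmetric])
    also have "(\<Sum>j<n. \<Sum>a<m. p i a * (x j * p j a)) = (\<Sum>a<m. p i a * (\<Sum>j<n. x j * p j a))"
      unfolding sum_distrib_left by (rule sum.swap)
    finally show ?thesis .
  qed

  \<comment> \<open>The points affinely span their space, so the center is an affine combination of
    them. Halving the coefficients gives a kernel vector that \<open>D\<close> maps to the all-ones
    vector.\<close>
  obtain b where b: "(\<Sum>i<n. b i) = 1 / 2" "?N b"
  proof -
    have full: "affine_span_dim P = m"
      using emb affine_span_dim_unique[OF P _ _ n(1)] unfolding embedding_dim_def by blast
    obtain x where x: "\<forall>a<m. (\<Sum>i<n. x i * (P $$ (i, a) - P $$ (0, a))) = c $ a - P $$ (0, a)"
      using affine_span_dim_eq_dim_imp_surj[OF P(1) full, of "\<lambda>a. c $ a - P $$ (0, a)"] by blast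
    define s where "s = (\<Sum>i<n. x i)"
    \<comment> \<open>The weight \<open>1 - s\<close> on point 0 makes the coefficients sum to 1
      before halving.\<close>
    define b where "b = (\<lambda>i. (x i + (if i = 0 then 1 - s else 0)) / 2)"
    have "(\<Sum>i<n. b i) = 1 / 2"
      using n by (simp add: b_def sum_divide_distrib[symmetric] sum.distrib s_def)
    moreover have "(\<Sum>i<n. b i * p i a) = 0" if "a < m" for a
    proof -
      have "(\<Sum>i<n. b i * p i a) =
        (\<Sum>i<n. (x i * (P $$ (i, a) - P $$ (0, a)) + x i * (P $$ (0, a) - c $ a)
          + (if i = 0 then (1 - s) * (P $$ (0, a) - c $ a) else 0)) / 2)"
        by (intro sum.cong refl) (auto simp: b_def p_def field_simps)
      also have "\<dots> = ((c $ a - P $$ (0, a)) + s * (P $$ (0, a) - c $ a)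
          + (1 - s) * (P $$ (0, a) - c $ a)) / 2"
        using n x that
        by (simp add: sum_divide_distrib[symmetric] sum.distrib s_def sum_distrib_right[symmetric])
      finally show ?thesis by (simp add: algebra_simps)
    qed
    ultimately show thesis using that by blast
  qed
  have Db: "(\<Sum>j<n. D $$ (i, j) * b j) = 1" if "i < n" for i
    using D_row[OF that, of b] b by simp

  \<comment> \<open>The vector \<open>w\<close>: its sum and its membership in the kernel\<close>
  have M: "M \<in> carrier_mat n n" "D * M * D = D"
    using assms(6) D by (auto simp: moore_penrose_inverse_def)
  have w: "w \<in> carrier_vec n" using assms(7) M by (simp add: ones_vec_def)
  \<comment> \<open>The all-ones vector is in the range of \<open>D\<close>, and
    \<open>D * M\<close> fixes that range.\<close>
  have "D *\<^sub>v w = ones_vec n"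
  proof -
    have "D *\<^sub>v vec n b = ones_vec n"
      using D Db by (intro eq_vecI) (auto simp: ones_vec_def scalar_prod_def atLeast0LessThan)
    then have "D *\<^sub>v w = D *\<^sub>v (M *\<^sub>v (D *\<^sub>v vec n b))" by (simp add: assms(7))
    also have "\<dots> = (D * M * D) *\<^sub>v vec n b"
      using D M(1) assoc_mult_mat_vec[OF D M(1), of "D *\<^sub>v vec n b"]
        assoc_mult_mat_vec[OF mult_carrier_mat[OF D M(1)] D, of "vec n b"]
      by (simp del: assoc_mult_mat)
    also have "\<dots> = ones_vec n" using M(2) \<open>D *\<^sub>v vec n b = ones_vec n\<close> by simp
    finally show ?thesis .
  qed
  then have Dw: "(\<Sum>j<n. D $$ (i, j) * w $ j) = 1" if "i < n" for i
    using that D w by (auto simp: vec_eq_iff ones_vec_def scalar_prod_def atLeast0LessThan)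
  \<comment> \<open>By symmetry of \<open>D\<close>, pairing \<open>w\<close> with
    \<open>D b\<close> equals pairing \<open>b\<close> with \<open>D w\<close>; these are the sums
    of \<open>w\<close> and of \<open>b\<close>.\<close>
  have w_sum: "(\<Sum>i<n. w $ i) = 1 / 2"
  proof -
    have "(\<Sum>i<n. w $ i) = (\<Sum>i<n. \<Sum>j<n. w $ i * (D $$ (i, j) * b j))"
      by (simp add: sum_distrib_left[symmetric] Db)
    also have "\<dots> = (\<Sum>j<n. \<Sum>i<n. w $ i * (D $$ (i, j) * b j))" by (rule sum.swap)
    also have "\<dots> = (\<Sum>j<n. b j * (\<Sum>i<n. D $$ (j, i) * w $ i))"
      unfolding sum_distrib_left by (intro sum.cong refl) (use D_sym in auto)
    also have "\<dots> = 1 / 2" using b(1) by (simp add: Dw)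
    finally show ?thesis .
  qed
  \<comment> \<open>The difference of \<open>w\<close> and \<open>b\<close> has sum 0 and is
    annihilated by \<open>D\<close>, so it lies in the kernel, as \<open>b\<close> does.\<close>
  have w_N: "?N (\<lambda>i. w $ i)"
  proof -
    define x where "x = (\<lambda>i. w $ i - b i)"
    have "(\<Sum>i<n. x i) = 0" by (simp add: x_def sum_subtractf w_sum b)
    moreover have "(\<Sum>i<n. \<Sum>j<n. x i * x j * D $$ (i, j)) = 0"
    proof -
      have "(\<Sum>j<n. D $$ (i, j) * x j) = 0" if "i < n" for i
        using Dw[OF that] Db[OF that] by (simp add: x_def right_diff_distrib sum_subtractf)
      then have "(\<Sum>i<n. x i * (\<Sum>j<n. D $$ (i, j) * x j)) = 0" by simp
      then show ?thesis by (simp add: sum_distrib_left mult_ac)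
    qed
    ultimately have "?N x" using kernel_iff_quadratic_form[where p = p and x = x] D_ij by blast
    then show ?thesis using b(2) by (simp add: x_def left_diff_distrib sum_subtractf)
  qed

  have split_N: "(\<forall>x. ?N x \<longrightarrow> x k = c * x l) \<longleftrightarrow> w $ k = c * w $ l \<and>
    (\<forall>x. (\<Sum>i<n. x i) = 0 \<and> ?N x \<longrightarrow> x k = c * x l)" for c
  proof (intro iffI allI impI conjI)
    fix x assume H: "w $ k = c * w $ l \<and> (\<forall>x. (\<Sum>i<n. x i) = 0 \<and> ?N x \<longrightarrow> x k = c * x l)"
      and x: "?N x"
    \<comment> \<open>As the entries of \<open>w\<close> sum to 1/2, the factor 2 makes the entries
      of \<open>g\<close> sum to 0.\<close>
    define s where "s = 2 * (\<Sum>i<n. x i)"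
    define g where "g = (\<lambda>i. x i - s * w $ i)"
    have "(\<Sum>i<n. g i) = 0"
      by (simp add: g_def sum_subtractf sum_distrib_left[symmetric] w_sum s_def)
    moreover have "(\<Sum>i<n. g i * p i a) = (\<Sum>i<n. x i * p i a) - s * (\<Sum>i<n. w $ i * p i a)" for a
      by (simp add: g_def left_diff_distrib sum_subtractf sum_distrib_left mult.assoc)
    then have "?N g" using x w_N by simp
    ultimately have "g k = c * g l" using H by blast
    then show "x k = c * x l" using H by (simp add: g_def algebra_simps)
  qed (use w_N in auto)

  \<comment> \<open>The sum-zero part of the kernel: the Gale space and \<open>Z\<close>\<close>
  obtain m' P' where P': "P' \<in> carrier_mat n m'" "generates P' D" "affine_span_dim P' = r"
    using assms(2) unfolding embedding_dim_def by blast
  have r_le: "r \<le> n - 1" using affine_span_dim_bound(1)[OF P'(1) n(1)] P'(3) by simp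
  \<comment> \<open>Here the points are affinely independent; the kernel condition passes from
    \<open>p\<close> to \<open>P'\<close> through the quadratic form.\<close>
  have gale_triv: "x i = 0" if r: "r = n - 1" and x: "(\<Sum>i<n. x i) = 0" "?N x" and i: "i < n" for x i
  proof (rule affine_span_dim_bound(2)[OF P'(1) n(1) _ x(1) _ i])
    show "affine_span_dim P' = n - 1" using P' r by simp
    have "(\<Sum>i<n. \<Sum>j<n. x i * x j * D $$ (i, j)) = 0"
      using kernel_iff_quadratic_form[where p = p and x = x] D_ij x by blast
    then have "\<forall>a<m'. (\<Sum>i<n. x i * P' $$ (i, a)) = 0"
      by (subst kernel_iff_quadratic_form[OF _ x(1)]) (use P' generates_iff in auto)
    then show "(\<Sum>i<n. x i * P' $$ (i, a)) = 0" if "a < m'" for a using that by blast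
  qed
  have gale: "(\<forall>x. (\<Sum>i<n. x i) = 0 \<and> ?N x \<longrightarrow> x k = c * x l) \<longleftrightarrow>
      (\<forall>v \<in> set (cols Z). v $ k = c * v $ l)" if r: "r \<le> n - 2" for c
  proof -
    obtain R where R: "R \<in> carrier_mat n r" "generates R D"
      "vectorspace.basis class_ring
        (module_vec TYPE(real) n\<lparr>carrier := gale_space n R\<rparr>) (set (cols Z))"
      using assms(8)[OF r] by (auto simp: gale_matrix_def)
    have gale_space: "gale_space n R = {x \<in> carrier_vec n. (\<Sum>i<n. x $ i) = 0 \<and> ?N (\<lambda>i. x $ i)}"
      by (rule gale_space_eq[OF R(1,2)]) (rule D_ij)
    have "(\<forall>v \<in> set (cols Z). v $ k = c * v $ l) \<longleftrightarrow> (\<forall>x \<in> gale_space n R. x $ k = c * x $ l)"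
      by (rule basis_gale_space_proportional_iff[OF R(1,3) kl(1,2)])
    also have "\<dots> \<longleftrightarrow> (\<forall>x. (\<Sum>i<n. x i) = 0 \<and> ?N x \<longrightarrow> x k = c * x l)"
    proof (intro iffI allI impI ballI)
      fix x assume H: "\<forall>x \<in> gale_space n R. x $ k = c * x $ l" and x: "(\<Sum>i<n. x i) = 0 \<and> ?N x"
      have "vec n x \<in> gale_space n R"
        using x unfolding gale_space by simp
      then show "x k = c * x l" using H kl by fastforce
    next
      fix v assume "\<forall>x. (\<Sum>i<n. x i) = 0 \<and> ?N x \<longrightarrow> x k = c * x l" "v \<in> gale_space n R"
      then show "v $ k = c * v $ l"
        unfolding gale_space by auto
    qed
    finally show ?thesis by blast
  qed
  have Z_row: "row Z k = c \<cdot>\<^sub>v row Z l \<longleftrightarrow> (\<forall>v \<in> set (cols Z). v $ k = c * v $ l)"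
    if "r \<le> n - 2" for c
  proof -
    have "mat_of_cols n (cols Z) = Z"
      using assms(8)[OF that] mat_of_cols_cols[of Z] by (auto simp: gale_matrix_def)
    then show ?thesis using row_mat_of_cols_eq_smult_iff[OF kl(1,2), of "cols Z" c] by simp
  qed
  \<comment> \<open>The same constant \<open>c\<close> stands on both sides, so the quantifier over
    nonzero \<open>c\<close> can be added afterwards.\<close>
  have main: "(\<forall>x. ?N x \<longrightarrow> x k = c * x l) \<longleftrightarrow>
      w $ k = c * w $ l \<and> (r \<le> n - 2 \<longrightarrow> row Z k = c \<cdot>\<^sub>v row Z l)" for c
  proof (cases "r \<le> n - 2")
    case True
    then show ?thesis unfolding split_N gale[OF True] Z_row[OF True] by simp
  next
    case False
    then have "r = n - 1" using r_le by simp
    then have "x k = c * x l" if "(\<Sum>i<n. x i) = 0 \<and> ?N x" for x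
      using gale_triv[of x] that kl by simp
    then show ?thesis unfolding split_N using False by blast
  qed
  have tilde: "row (Z_tilde n r w Z) k = c \<cdot>\<^sub>v row (Z_tilde n r w Z) l \<longleftrightarrow>
      w $ k = c * w $ l \<and> (r \<le> n - 2 \<longrightarrow> row Z k = c \<cdot>\<^sub>v row Z l)" for c
  proof (cases "r = n - 1")
    case True
    \<comment> \<open>Since \<open>n\<close> is at least 2, truncated subtraction does not merge the
      two cases for \<open>r\<close>.\<close>
    then have "\<not> r \<le> n - 2" using n by simp
    then show ?thesis
      using True row_mat_of_cols_eq_smult_iff[OF kl(1,2), of "[w]" c] by (simp add: Z_tilde_def)
  next
    case False
    then have r: "r \<le> n - 2" using r_le by simp
    show ?thesis
      using False r Z_row[OF r, of c] row_mat_of_cols_eq_smult_iff[OF kl(1,2), of "w # cols Z" c]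
      by (simp add: Z_tilde_def)
  qed
  have "T_le n D k l = {0} \<longleftrightarrow> \<not> (\<exists>c. c \<noteq> 0 \<and> (\<forall>x. ?N x \<longrightarrow> x k = c * x l))"
    by (rule T_le_trivial_iff[OF D D_ij unit kl])
  then show ?thesis unfolding main parallel_def tilde by blast
qed

end
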